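(* Let $k\ge 3$ be an integer and let $\vec{D}$ be a strongly connected digraph that is $\vec{P_k}^*$-free. Then $c(\vec{D})\le k-2$.
   Context: A digraph is a finite directed graph with no loops and no parallel arcs (two arcs with the same tail and the same head), which is weakly connected. A pair of opposite arcs $uv$ and $vu$ is allowed. Game of cops and robbers on a digraph $\vec{D}$: the cop player has $k\ge 1$ pieces (cops) and the robber has one piece. First the cop player places the $k$ cops on (not necessarily distinct) vertices, then the robber chooses a vertex. In each round, first each cop either stays or moves along an arc from its current vertex (tail) to the head of that arc; then the robber either stays or moves along an arc from tail to head. The cops win if at some point some cop is on the same vertex as the robber; the robber wins if he is never caught. Both players have complete information. The cop number $c(\vec{D})$ is the minimum number of cops that have a winning strategy. The adjacency matrix of a digraph has entry $a_{uv}=1$ if there is an arc with tail $u$ and head $v$, and $a_{uv}=0$ otherwise. $\vec{P_k}$ is the directed path $v_1\to v_2\to\cdots\to v_k$ on $k$ vertices, with vertices ordered along the path. A digraph $\vec{D}$ is $\vec{P_k}^*$-free if it has no induced subdigraph whose adjacency matrix, for some ordering of its vertices, has the same upper triangular part as that of $\vec{P_k}$. Explicitly: there are no distinct vertices $w_1,\dots,w_k$ of $\vec{D}$ such that for all $1\le i<j\le k$, there is an arc from $w_i$ to $w_j$ if and only if $j=i+1$ (arcs from $w_j$ to $w_i$ with $i<j$ being unrestricted). *)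

theory Defs
  imports "Graph_Theory.Digraph_Component"
begin

section \<open>The game of cops and robbers\<close>

definition game_step :: "('a, 'b) pre_digraph \<Rightarrow> 'a \<Rightarrow> 'a \<Rightarrow> bool" where
  "game_step G u v \<longleftrightarrow> u = v \<or> u \<rightarrow>\<^bsub>G\<^esub> v"

text \<open>
  The robber chooses the vertex \<open>r 0\<close> after the cops have been placed and moves from
  \<open>r t\<close> to \<open>r (Suc t)\<close> in round \<open>Suc t\<close>.
\<close>

definition robber_play :: "('a, 'b) pre_digraph \<Rightarrow> (nat \<Rightarrow> 'a) \<Rightarrow> bool" where
  "robber_play G r \<longleftrightarrow> r 0 \<in> verts G \<and> (\<forall>t. game_step G (r t) (r (Suc t)))"

text \<open>
  Given the list of all positions of the robber so far, a strategy of the cops says where each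
  cop (numbered by a natural number) goes next; the empty list gives the initial placement.
  As the cops know their own strategy, this list determines the complete history of the game.
  \<open>cop_pos S r t\<close> are the positions of the cops after their move in round \<open>t\<close>, hence at the
  moment when the robber goes to \<open>r t\<close>; round \<open>0\<close> is the placement.
\<close>

type_synonym 'a cop_strategy = "'a list \<Rightarrow> nat \<Rightarrow> 'a"

definition cop_pos :: "'a cop_strategy \<Rightarrow> (nat \<Rightarrow> 'a) \<Rightarrow> nat \<Rightarrow> nat \<Rightarrow> 'a" where
  "cop_pos S r t = S (map r [0..<t])"

definition legal_strategy :: "('a, 'b) pre_digraph \<Rightarrow> nat \<Rightarrow> 'a cop_strategy \<Rightarrow> bool" where
  "legal_strategy G k S \<longleftrightarrow>
     (\<forall>i<k. S [] i \<in> verts G) \<and>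
     (\<forall>r. robber_play G r \<longrightarrow>
        (\<forall>t. \<forall>i<k. game_step G (cop_pos S r t i) (cop_pos S r (Suc t) i)))"

text \<open>
  The robber can be caught by his own move to \<open>r t\<close>, or by the cops' following move. Plays are
  infinite: what happens after the capture is irrelevant, since both sides may stay forever.
\<close>

definition captured :: "nat \<Rightarrow> 'a cop_strategy \<Rightarrow> (nat \<Rightarrow> 'a) \<Rightarrow> bool" where
  "captured k S r \<longleftrightarrow> (\<exists>t. \<exists>i<k. cop_pos S r t i = r t \<or> cop_pos S r (Suc t) i = r t)"

definition cops_win :: "('a, 'b) pre_digraph \<Rightarrow> nat \<Rightarrow> bool" where
  "cops_win G k \<longleftrightarrow>
     (\<exists>S. legal_strategy G k S \<and> (\<forall>r. robber_play G r \<longrightarrow> captured k S r))"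

definition cop_number :: "('a, 'b) pre_digraph \<Rightarrow> nat" where
  "cop_number G = (LEAST k. k \<ge> 1 \<and> cops_win G k)"

text \<open>The minimum exists, since one cop on every vertex wins at once.\<close>

lemma cops_win_card_verts:
  assumes "finite (verts G)"
  shows "cops_win G (card (verts G))"
proof -
  obtain f where f: "bij_betw f {0..<card (verts G)} (verts G)"
    using ex_bij_betw_nat_finite[OF assms] by blast
  define S :: "'a cop_strategy" where "S = (\<lambda>h. f)"
  have "legal_strategy G (card (verts G)) S"
    using bij_betw_apply[OF f]
    by (auto simp: legal_strategy_def cop_pos_def S_def game_step_def)
  moreover have "captured (card (verts G)) S r" if "robber_play G r" for r
  proof -
    have "r 0 \<in> f ` {0..<card (verts G)}"
      using that f by (simp add: robber_play_def bij_betw_def)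
    then obtain i where "i < card (verts G)" "f i = r 0"
      by auto
    then show ?thesis
      unfolding captured_def cop_pos_def S_def by blast
  qed
  ultimately show ?thesis
    unfolding cops_win_def by blast
qed

lemma cop_number_wins:
  assumes "finite (verts G)" and "verts G \<noteq> {}"
  shows "cop_number G \<ge> 1" and "cops_win G (cop_number G)"
proof -
  have "card (verts G) \<ge> 1 \<and> cops_win G (card (verts G))"
    using assms cops_win_card_verts[of G] by (simp add: Suc_le_eq card_gt_0_iff)
  then have "cop_number G \<ge> 1 \<and> cops_win G (cop_number G)"
    unfolding cop_number_def by (rule LeastI)
  then show "cop_number G \<ge> 1" and "cops_win G (cop_number G)"
    by auto
qed


section \<open>Digraphs free of a starred path\<close>

definition adjacency :: "('a, 'b) pre_digraph \<Rightarrow> 'a \<Rightarrow> 'a \<Rightarrow> nat" where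
  "adjacency G u v = (if u \<rightarrow>\<^bsub>G\<^esub> v then 1 else 0)"

text \<open>The vertices of the path are \<open>0, \<dots>, k - 1\<close>, in the order along the path.\<close>

definition directed_path :: "nat \<Rightarrow> (nat, nat \<times> nat) pre_digraph" where
  "directed_path k =
     \<lparr>verts = {..<k}, arcs = {(i, Suc i) | i. Suc i < k}, tail = fst, head = snd\<rparr>"

text \<open>
  The list \<open>ws\<close> is an ordering of the vertices of the induced subdigraph \<open>H\<close>. Only the entries
  strictly above the diagonal are compared; the diagonals vanish as there are no loops.
\<close>

definition path_star_free :: "nat \<Rightarrow> ('a, 'b) pre_digraph \<Rightarrow> bool" where
  "path_star_free k G \<longleftrightarrow>
     \<not> (\<exists>H ws. induced_subgraph H G \<and> distinct ws \<and> set ws = verts H \<and> length ws = k \<and>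
          (\<forall>i j. i < j \<and> j < k \<longrightarrow>
             adjacency H (ws ! i) (ws ! j) = adjacency (directed_path k) i j))"

lemma (in wf_digraph) path_star_free_iff:
  "path_star_free k G \<longleftrightarrow>
     \<not> (\<exists>ws. distinct ws \<and> set ws \<subseteq> verts G \<and> length ws = k \<and>
          (\<forall>i j. i < j \<and> j < k \<longrightarrow> (ws ! i \<rightarrow> ws ! j) = (j = Suc i)))"
proof -
  have path: "(i \<rightarrow>\<^bsub>directed_path k\<^esub> j) \<longleftrightarrow> j = Suc i" if "j < k" for i j
    using that by (force simp: directed_path_def arcs_ends_conv)
  have sub: "(u \<rightarrow>\<^bsub>H\<^esub> v) \<longleftrightarrow> (u \<rightarrow> v)"
    if "induced_subgraph H G" "u \<in> verts H" "v \<in> verts H" for H u v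
    using that
    by (auto simp: induced_subgraph_def subgraph_def compatible_def arcs_ends_conv image_iff)
  have "(\<exists>H. induced_subgraph H G \<and> set ws = verts H) \<longleftrightarrow> set ws \<subseteq> verts G" for ws
  proof
    assume "set ws \<subseteq> verts G"
    then show "\<exists>H. induced_subgraph H G \<and> set ws = verts H"
      by (intro exI[of _ "G \<restriction> set ws"]) (simp add: induced_induce)
  qed (auto simp: induced_subgraph_def subgraph_def)
  moreover have "adjacency H (ws ! i) (ws ! j) = adjacency (directed_path k) i j \<longleftrightarrow>
      (ws ! i \<rightarrow> ws ! j) = (j = Suc i)"
    if "induced_subgraph H G" "set ws = verts H" "length ws = k" "i < j" "j < k" for H ws i j
  proof -
    have "ws ! i \<in> verts H" "ws ! j \<in> verts H"
      using that nth_mem[of _ ws] by auto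
    then show ?thesis
      using that path[of j i] sub[of H "ws ! i" "ws ! j"] by (simp add: adjacency_def)
  qed
  ultimately show ?thesis
    unfolding path_star_free_def by (smt (verit))
qed

end

theory Submission
  imports Defs
begin

text \<open>
  The cops chase the robber along a directed path that has no forward chord. All of them start
  on one vertex \<open>v\<close>. Strong connectivity gives a chordless path from \<open>v\<close> to the robber. In every
  round one cop stays behind on each vertex of the path that has already been visited, and the
  others, who form a pile at the front, advance by one vertex along the path. Suppose that the
  robber answers with a move to \<open>y\<close>. Every occupied vertex guards itself and its
  out-neighbours, so the robber is caught at once if one of them dominates \<open>y\<close>, that is, equals
  \<open>y\<close> or has an arc to it. Otherwise the first vertex of the path that dominates \<open>y\<close> lies beyond
  the cops, and going from there directly to \<open>y\<close> yields a path to the robber that still begins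
  with the occupied vertices (\<open>star_path_extend\<close>). It is chordless again: no earlier vertex has
  an arc to \<open>y\<close>, and arcs from \<open>y\<close> back to the path are not forward chords.

  The occupied part thus grows by one vertex per round. A chordless path has at most \<open>k - 1\<close>
  vertices, so once \<open>k - 2\<close> of them are occupied, the robber is on the last occupied vertex or
  on the next one, and he is caught (\<open>cops_win_along_star_path\<close>).

  That argument speaks about positions only. The passage to strategies, which see the history
  of the game, is \<open>cops_win_if_within\<close>.
\<close>

section \<open>Winning positions with a bounded number of rounds\<close>

text \<open>
  The positions, with the cops to move, in which the cops can force a capture by at most
  \<open>n\<close> further moves followed by the capturing one. The bound replaces a rank function on winning
  positions: a strategy can read it off the length of the history.
\<close>

fun cops_win_within ::
  "('a, 'b) pre_digraph \<Rightarrow> nat \<Rightarrow> nat \<Rightarrow> (nat \<Rightarrow> 'a) \<Rightarrow> 'a \<Rightarrow> bool" where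
  "cops_win_within G k 0 c x \<longleftrightarrow> (\<exists>i<k. game_step G (c i) x)"
| "cops_win_within G k (Suc n) c x \<longleftrightarrow> (\<exists>i<k. game_step G (c i) x) \<or>
     (\<exists>c'. (\<forall>i<k. game_step G (c i) (c' i)) \<and>
        (\<forall>y. game_step G x y \<longrightarrow> cops_win_within G k n c' y))"

lemma game_step_refl [simp]: "game_step G u u"
  by (simp add: game_step_def)

lemma cops_win_within_if_guarded:
  assumes "i < k" and "game_step G (c i) x"
  shows "cops_win_within G k n c x"
  using assms by (cases n) auto

text \<open>
  In a position that is not won in time the cops stay where they are, so that a legal answer exists in every
  position. A strategy assembled from such answers is legal against every play, also one that
  goes on after the capture.
\<close>

lemma cops_answer_exists:
  "\<exists>c'. (\<forall>i<k. game_step G (c i) (c' i)) \<and>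
     (cops_win_within G k n c x \<longrightarrow> (\<exists>i<k. c' i = x) \<or>
        (\<exists>m. n = Suc m \<and> (\<forall>y. game_step G x y \<longrightarrow> cops_win_within G k m c' y)))"
proof (cases "\<exists>i<k. game_step G (c i) x")
  case True
  then obtain i where "i < k" "game_step G (c i) x"
    by blast
  then show ?thesis
    by (intro exI[of _ "c(i := x)"]) auto
next
  case False
  show ?thesis
  proof (cases "cops_win_within G k n c x")
    case True
    with False show ?thesis
      by (cases n) auto
  next
    case False
    then show ?thesis
      by (intro exI[of _ c]) simp
  qed
qed

lemma cops_win_if_within:
  assumes c0: "\<forall>i<k. c0 i \<in> verts G"
    and win: "\<forall>x \<in> verts G. cops_win_within G k n c0 x"
  shows "cops_win G k"
proof -
  let ?good = "\<lambda>m c x c'. (\<forall>i<k. game_step G (c i) (c' i)) \<and>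
     (cops_win_within G k m c x \<longrightarrow> (\<exists>i<k. c' i = x) \<or>
        (\<exists>m'. m = Suc m' \<and> (\<forall>y. game_step G x y \<longrightarrow> cops_win_within G k m' c' y)))"
  define answer where "answer m c x = (SOME c'. ?good m c x c')" for m c x
  have answer: "?good m c x (answer m c x)" for m c x
    unfolding answer_def using someI_ex[OF cops_answer_exists[of k G c m x]] .
  \<comment> \<open>The recursion consumes the history from its most recent entry, hence the reversal.\<close>
  define S :: "'a cop_strategy" where
    "S h = rec_list c0 (\<lambda>x past c. answer (n - length past) c x) (rev h)" for h
  have pos_0: "cop_pos S r 0 = c0" for r
    by (simp add: cop_pos_def S_def)
  have pos_Suc: "cop_pos S r (Suc t) = answer (n - t) (cop_pos S r t) (r t)" for r t
    by (simp add: cop_pos_def S_def)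
  have "legal_strategy G k S"
    using c0 answer by (simp add: legal_strategy_def pos_Suc) (simp add: S_def)
  moreover have "captured k S r" if r: "robber_play G r" for r
  proof (rule ccontr)
    assume "\<not> captured k S r"
    then have free: "\<not> (\<exists>i<k. answer (n - t) (cop_pos S r t) (r t) i = r t)" for t
      unfolding captured_def pos_Suc by blast
    have "t \<le> n \<and> cops_win_within G k (n - t) (cop_pos S r t) (r t)" for t
    proof (induction t)
      case 0
      show ?case
        using r win by (simp add: pos_0 robber_play_def)
    next
      case (Suc t)
      then have "cops_win_within G k (n - t) (cop_pos S r t) (r t)"
        by blast
      then obtain m where "n - t = Suc m" and
        all: "\<forall>y. game_step G (r t) y \<longrightarrow>
          cops_win_within G k m (answer (n - t) (cop_pos S r t) (r t)) y"
        using answer[of "cop_pos S r t" "n - t" "r t"] free[of t] by blast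
      have "cops_win_within G k m (answer (n - t) (cop_pos S r t) (r t)) (r (Suc t))"
        using all r by (simp add: robber_play_def)
      moreover have "Suc t \<le> n" "m = n - Suc t"
        using \<open>n - t = Suc m\<close> by auto
      ultimately show ?case
        by (simp add: pos_Suc)
    qed
    from this[of "Suc n"] show False
      by simp
  qed
  ultimately show ?thesis
    unfolding cops_win_def by blast
qed


section \<open>Paths without forward chords\<close>

definition star_path :: "('a, 'b) pre_digraph \<Rightarrow> 'a list \<Rightarrow> bool" where
  "star_path G ws \<longleftrightarrow> distinct ws \<and> set ws \<subseteq> verts G \<and>
     (\<forall>i j. i < j \<and> j < length ws \<longrightarrow> (ws ! i \<rightarrow>\<^bsub>G\<^esub> ws ! j) = (j = Suc i))"

lemma star_path_take: "star_path G ws \<Longrightarrow> star_path G (take n ws)"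
  using set_take_subset[of n ws] by (auto simp: star_path_def)

lemma star_path_snoc:
  assumes "star_path G ws" and "ws \<noteq> []" and "y \<in> verts G" and "last ws \<rightarrow>\<^bsub>G\<^esub> y"
    and "y \<notin> set ws" and "\<And>p. p \<in> set (butlast ws) \<Longrightarrow> \<not> p \<rightarrow>\<^bsub>G\<^esub> y"
  shows "star_path G (ws @ [y])"
proof -
  have "(ws ! i \<rightarrow>\<^bsub>G\<^esub> y) = (length ws = Suc i)" if "i < length ws" for i
  proof (cases "length ws = Suc i")
    case True
    then show ?thesis
      using assms(2,4) by (simp add: last_conv_nth)
  next
    case False
    then have "i < length (butlast ws)"
      using that by simp
    then show ?thesis
      using False assms(6) by (metis nth_butlast nth_mem)
  qed
  then have "((ws @ [y]) ! i \<rightarrow>\<^bsub>G\<^esub> (ws @ [y]) ! j) = (j = Suc i)"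
    if "i < j" "j < length (ws @ [y])" for i j
    using that assms(1) unfolding star_path_def by (cases "j < length ws") (auto simp: nth_append)
  moreover have "distinct (ws @ [y])" "set (ws @ [y]) \<subseteq> verts G"
    using assms(1,3,5) by (auto simp: star_path_def)
  ultimately show ?thesis
    unfolding star_path_def by blast
qed

text \<open>
  A vertex of the path dominates \<open>y\<close> if it is \<open>y\<close> or has an arc to it. Cutting the path after
  the first such vertex, and appending \<open>y\<close> if need be, creates no forward chord because no
  earlier vertex has an arc to \<open>y\<close>. If the first \<open>j\<close> vertices do not dominate \<open>y\<close>, the
  cut comes after at least \<open>j + 1\<close> vertices.
\<close>

lemma star_path_extend:
  assumes path: "star_path G ws" and j: "j < length ws"
    and y: "y \<in> verts G" "game_step G (last ws) y"
    and unguarded: "\<And>i. i < j \<Longrightarrow> \<not> game_step G (ws ! i) y"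
  obtains ws' where "star_path G ws'" "ws' \<noteq> []" "last ws' = y"
    "take (Suc j) ws' = take (Suc j) ws" "j < length ws'"
proof -
  define m where "m = (LEAST m. game_step G (ws ! m) y)"
  have last: "game_step G (ws ! (length ws - 1)) y"
    using y(2) j last_conv_nth[of ws] by force
  have m: "game_step G (ws ! m) y"
    unfolding m_def using last by (rule LeastI)
  have first: "\<not> game_step G (ws ! i) y" if "i < m" for i
    using that unfolding m_def by (rule not_less_Least)
  have "m < length ws"
    using Least_le[of "\<lambda>m. game_step G (ws ! m) y", OF last] j by (simp add: m_def)
  have "j \<le> m"
    using unguarded m not_le by blast
  let ?p = "take (Suc m) ws"
  have split: "?p = take m ws @ [ws ! m]"
    using \<open>m < length ws\<close> by (rule take_Suc_conv_app_nth)
  have p: "star_path G ?p" "?p \<noteq> []" "last ?p = ws ! m" "take (Suc j) ?p = take (Suc j) ws"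
      "j < length ?p"
  proof -
    show "star_path G ?p"
      using path by (rule star_path_take)
    show "last ?p = ws ! m"
      unfolding split by simp
  qed (use \<open>m < length ws\<close> \<open>j \<le> m\<close> in \<open>auto simp: min_absorb1\<close>)
  show ?thesis
  proof (cases "ws ! m = y")
    case True
    then show ?thesis
      using p that by blast
  next
    case False
    have early: "\<not> game_step G p y" if "p \<in> set (take m ws)" for p
      using that first by (auto simp: in_set_conv_nth)
    have "star_path G (?p @ [y])"
    proof (rule star_path_snoc)
      show "last ?p \<rightarrow>\<^bsub>G\<^esub> y"
        using m False p(3) by (simp add: game_step_def)
      show "y \<notin> set ?p"
        using early[of y] False unfolding split by auto
      show "\<not> p \<rightarrow>\<^bsub>G\<^esub> y" if "p \<in> set (butlast ?p)" for p
        using early[of p] that unfolding split by (simp add: game_step_def)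
    qed (use p y in auto)
    then show ?thesis
      using p by (intro that[of "?p @ [y]"]) auto
  qed
qed

lemma star_path_if_reachable:
  assumes "u \<rightarrow>\<^sup>*\<^bsub>G\<^esub> v"
  shows "\<exists>ws. star_path G ws \<and> ws \<noteq> [] \<and> hd ws = u \<and> last ws = v"
  using assms unfolding reachable_def
proof (induction rule: rtrancl_on_induct)
  case base
  then show ?case
    by (intro exI[of _ "[u]"]) (simp add: star_path_def)
next
  case (step v w)
  then obtain ws where ws: "star_path G ws" "ws \<noteq> []" "hd ws = u" "last ws = v"
    by blast
  have "game_step G (last ws) w"
    using step ws by (simp add: game_step_def)
  moreover have "w \<in> verts G" "0 < length ws"
    using step ws by auto
  ultimately obtain ws' where ws': "star_path G ws'" "ws' \<noteq> []" "last ws' = w"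
      "take (Suc 0) ws' = take (Suc 0) ws"
    using star_path_extend[OF ws(1), of 0 w] by blast
  then have "hd ws' = hd ws"
    using ws(2) by (metis hd_take zero_less_Suc)
  then show ?case
    using ws' ws(3) by blast
qed

lemma (in wf_digraph) star_path_length_less:
  assumes "path_star_free k G" and "star_path G ws"
  shows "length ws < k"
proof (rule ccontr)
  assume "\<not> length ws < k"
  then have len: "length (take k ws) = k"
    by simp
  have "star_path G (take k ws)"
    using assms(2) by (rule star_path_take)
  then have "\<exists>us. distinct us \<and> set us \<subseteq> verts G \<and> length us = k \<and>
      (\<forall>i j. i < j \<and> j < k \<longrightarrow> (us ! i \<rightarrow> us ! j) = (j = Suc i))"
    unfolding star_path_def len using len by blast
  then show False
    using assms(1) unfolding path_star_free_iff by blast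
qed


section \<open>Chasing the robber along a path\<close>

lemma game_step_along_star_path:
  assumes "star_path G ws" and "i < length ws" and "j = i \<or> j = Suc i" and "j < length ws"
  shows "game_step G (ws ! i) (ws ! j)"
  using assms unfolding star_path_def game_step_def by blast

lemma game_step_last_star_path:
  assumes "star_path G ws" and "j < length ws" and "length ws \<le> Suc (Suc j)"
  shows "game_step G (ws ! j) (last ws)"
proof -
  have "last ws = ws ! (length ws - 1)"
    using assms(2) by (intro last_conv_nth) auto
  moreover have "length ws - 1 = j \<or> length ws - 1 = Suc j" "length ws - 1 < length ws"
    using assms(2,3) by linarith+
  ultimately show ?thesis
    using game_step_along_star_path[OF assms(1,2)] by simp
qed

text \<open>
  The cops on \<open>ws ! 0, \<dots>, ws ! (j - 1)\<close> are alone, and all others are on \<open>ws ! j\<close>. The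
  bound on the lengths makes the robber's lead one arc at most when every
  cop has its own vertex, that is, when \<open>j = K - 1\<close>.
\<close>

lemma (in wf_digraph) cops_win_along_star_path:
  assumes short: "\<And>ws. star_path G ws \<Longrightarrow> length ws \<le> Suc K"
    and "star_path G ws" and "j < length ws" and "j + n = K - 1" and "K > 0"
  shows "cops_win_within G K n (\<lambda>i. ws ! min i j) (last ws)"
  using assms(2-4)
proof (induction n arbitrary: j ws)
  case (0 j ws)
  then have j: "j < K" "length ws \<le> Suc (Suc j)"
    using \<open>K > 0\<close> short[of ws] by auto
  then have "game_step G (ws ! j) (last ws)"
    using 0 by (intro game_step_last_star_path)
  then show ?case
    using j(1) by (intro cops_win_within_if_guarded[of j]) auto
next
  case (Suc n j ws)
  have j: "Suc j < K"
    using Suc.prems(3) by simp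
  show ?case
  proof (cases "Suc (Suc j) < length ws")
    case False
    then have "game_step G (ws ! j) (last ws)"
      using Suc.prems by (intro game_step_last_star_path) auto
    then show ?thesis
      using j by (intro cops_win_within_if_guarded[of j]) auto
  next
    case True
    have forward: "game_step G (ws ! min i j) (ws ! min i (Suc j))" for i
      using True by (intro game_step_along_star_path[OF Suc.prems(1)]) (auto simp: min_def)
    have "cops_win_within G K n (\<lambda>i. ws ! min i (Suc j)) y" if y: "game_step G (last ws) y" for y
    proof (cases "\<exists>i\<le>Suc j. game_step G (ws ! i) y")
      case True
      then obtain i where "i \<le> Suc j" "game_step G (ws ! i) y"
        by blast
      then show ?thesis
        using j by (intro cops_win_within_if_guarded[of i]) auto
    next
      case False
      have "last ws \<in> verts G"
        using Suc.prems(1,2) last_in_set[of ws] unfolding star_path_def by fastforce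
      then have "y \<in> verts G"
        using y by (auto simp: game_step_def)
      moreover have "\<not> game_step G (ws ! i) y" if "i < Suc j" for i
        using False that by auto
      ultimately obtain ws' where ws': "star_path G ws'" "last ws' = y"
          "take (Suc (Suc j)) ws' = take (Suc (Suc j)) ws" "Suc j < length ws'"
        using star_path_extend[OF Suc.prems(1), of "Suc j" y] True y by force
      have same: "ws' ! min i (Suc j) = ws ! min i (Suc j)" for i
        using ws'(3) nth_take[of "min i (Suc j)" "Suc (Suc j)"] by (metis less_Suc_eq_le min.cobounded2)
      have "cops_win_within G K n (\<lambda>i. ws' ! min i (Suc j)) (last ws')"
        using ws' Suc.prems(3) by (intro Suc.IH) auto
      then show ?thesis
        by (simp add: same ws'(2))
    qed
    then show ?thesis
      unfolding cops_win_within.simps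
      by (intro disjI2 exI[of _ "\<lambda>i. ws ! min i (Suc j)"]) (simp add: forward)
  qed
qed

theorem theorem3:
  fixes G :: "('a, 'b) pre_digraph" and k :: nat
  assumes "k \<ge> 3"
    and "digraph G"
    and "strongly_connected G"
    and "path_star_free k G"
  shows "cop_number G \<le> k - 2"
proof -
  interpret digraph G
    by fact
  obtain v where v: "v \<in> verts G"
    using assms(3) by (auto simp: strongly_connected_def)
  have "cops_win_within G (k - 2) (k - 3) (\<lambda>_. v) x" if "x \<in> verts G" for x
  proof -
    have "v \<rightarrow>\<^sup>*\<^bsub>G\<^esub> x"
      using assms(3) v that unfolding strongly_connected_def by blast
    from star_path_if_reachable[OF this]
    obtain ws where ws: "star_path G ws" "ws \<noteq> []" "hd ws = v" "last ws = x"
      by blast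
    have "length ws' \<le> Suc (k - 2)" if "star_path G ws'" for ws'
      using star_path_length_less[OF assms(4) that] assms(1) by linarith
    then have "cops_win_within G (k - 2) (k - 3) (\<lambda>i. ws ! min i 0) (last ws)"
      using ws assms(1) by (intro cops_win_along_star_path) auto
    then show ?thesis
      using ws by (simp add: hd_conv_nth)
  qed
  then have "cops_win G (k - 2)"
    using v by (intro cops_win_if_within[of _ "\<lambda>_. v"]) auto
  then show ?thesis
    unfolding cop_number_def using assms(1) by (intro Least_le) auto
qed

end
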